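(* Let $n\ge 2$ and let $\mathcal{L}_n$ be the set of linearly ordered factorizations of the $n$-cycle $(1,2,\dots,n)$. With the descent set of $u\in\mathcal{L}_n$ defined by $\mathrm{Des}(u)=\mathrm{Des}(\phi(u))\subseteq[n-2]$, the quasisymmetric function $\mathcal{Q}(\mathcal{L}_n)=\sum_{u\in\mathcal{L}_n}\mathcal{F}_{n-1,\mathrm{Des}(u)}$ satisfies $$\mathcal{Q}(\mathcal{L}_n)=\sum_{k=0}^{n-2}(k+1)\,s_{(n-1-k,1^k)}.$$ In particular, $\mathcal{L}_n$ is Schur-positive.
   Context: $[m]=\{1,\dots,m\}$ and $\mathfrak{S}_m$ is the symmetric group on $[m]$. Products of permutations are composed right to left. $F_n$ is the set of sequences $(t_1,\dots,t_{n-1})$ of transpositions in $\mathfrak{S}_n$ with $t_1t_2\cdots t_{n-1}=(1,2,\dots,n)$ (the $n$-cycle $1\mapsto2\mapsto\cdots\mapsto n\mapsto1$). An element $(t_1,\dots,t_{n-1})\in F_n$ is called linearly ordered if for every $1\le i\le n-2$ the transpositions $t_i$ and $t_{i+1}$ have a common letter; $\mathcal{L}_n\subseteq F_n$ is the set of linearly ordered factorizations. The map $\phi:F_n\to\mathfrak{S}_{n-1}$ (edge labeling of Adin and Roichman) is defined as follows. For $w=(t_1,\dots,t_{n-1})\in F_n$ put $\sigma_j=t_jt_{j+1}\cdots t_{n-1}$ for $1\le j\le n-1$ and $\sigma_n=\mathrm{id}$, and $A_j=\{1\le i\le n-1:\sigma_j(i)>\sigma_{j+1}(i)\}$. It is known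 that each $A_j$ has exactly one element and that $\phi(w)(j)=i$, where $A_j=\{i\}$, defines a permutation $\phi(w)\in\mathfrak{S}_{n-1}$. For $\pi\in\mathfrak{S}_m$, $\mathrm{Des}(\pi)=\{1\le i\le m-1:\pi(i)>\pi(i+1)\}$. For $D\subseteq[m-1]$, Gessel's fundamental quasisymmetric function is $\mathcal{F}_{m,D}=\sum x_{i_1}x_{i_2}\cdots x_{i_m}$, the sum over $i_1\le i_2\le\cdots\le i_m$ with $i_j<i_{j+1}$ whenever $j\in D$. $s_\lambda$ is the Schur function of the partition $\lambda$; $(a,1^k)$ is the hook partition with one part $a$ and $k$ parts equal to $1$. A set with a descent map is Schur-positive if its associated quasisymmetric function $\mathcal{Q}$ is symmetric and its coefficients in the Schur basis are non-negative integers. *)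

theory Defs
  imports
    "HOL-Library.Multiset"
    "HOL-Combinatorics.Permutations"
    "HOL-Combinatorics.Cycles"
begin

definition transpositions :: "nat \<Rightarrow> (nat \<Rightarrow> nat) set" where
  "transpositions n = {transpose a b | a b. a \<in> {1..n} \<and> b \<in> {1..n} \<and> a \<noteq> b}"

text \<open>Products are composed right to left: \<open>perm_prod [t\<^sub>1, \<dots>, t\<^sub>k] = t\<^sub>1 \<circ> \<dots> \<circ> t\<^sub>k\<close>.\<close>

definition perm_prod :: "(nat \<Rightarrow> nat) list \<Rightarrow> nat \<Rightarrow> nat" where
  "perm_prod ts = foldr (\<circ>) ts id"

definition long_cycle :: "nat \<Rightarrow> nat \<Rightarrow> nat" where
  "long_cycle n = cycle_of_list [1..<Suc n]"

definition factorizations :: "nat \<Rightarrow> (nat \<Rightarrow> nat) list set" where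
  "factorizations n =
     {w. length w = n - 1 \<and> set w \<subseteq> transpositions n \<and> perm_prod w = long_cycle n}"

definition letters :: "(nat \<Rightarrow> nat) \<Rightarrow> nat set" where
  "letters t = {x. t x \<noteq> x}"

text \<open>Lists are indexed from 0, so the factor \<open>t\<^sub>i\<close> of \<open>w\<close> is \<open>w ! (i - 1)\<close>.\<close>

definition linearly_ordered :: "(nat \<Rightarrow> nat) list \<Rightarrow> bool" where
  "linearly_ordered w \<longleftrightarrow>
     (\<forall>i. 1 \<le> i \<and> i < length w \<longrightarrow> letters (w ! (i - 1)) \<inter> letters (w ! i) \<noteq> {})"

definition linear_factorizations :: "nat \<Rightarrow> (nat \<Rightarrow> nat) list set" where
  "linear_factorizations n = {w \<in> factorizations n. linearly_ordered w}"

definition partial_prod :: "(nat \<Rightarrow> nat) list \<Rightarrow> nat \<Rightarrow> nat \<Rightarrow> nat" where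
  "partial_prod w j = perm_prod (drop (j - 1) w)"

definition drop_set :: "nat \<Rightarrow> (nat \<Rightarrow> nat) list \<Rightarrow> nat \<Rightarrow> nat set" where
  "drop_set n w j = {i \<in> {1..n - 1}. partial_prod w j i > partial_prod w (j + 1) i}"

text \<open>For \<open>w \<in> factorizations n\<close> each \<open>drop_set n w j\<close> with \<open>1 \<le> j \<le> n - 1\<close> is a singleton,
  whose element is the label. Outside \<open>{1..n - 1}\<close> the value is fixed so that
  \<open>edge_labeling n w\<close> permutes \<open>{1..n - 1}\<close>.\<close>

definition edge_labeling :: "nat \<Rightarrow> (nat \<Rightarrow> nat) list \<Rightarrow> nat \<Rightarrow> nat" where
  "edge_labeling n w j = (if j \<in> {1..n - 1} then the_elem (drop_set n w j) else j)"

definition perm_Des :: "nat \<Rightarrow> (nat \<Rightarrow> nat) \<Rightarrow> nat set" where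
  "perm_Des m \<pi> = {i \<in> {1..m - 1}. \<pi> i > \<pi> (i + 1)}"

definition fact_Des :: "nat \<Rightarrow> (nat \<Rightarrow> nat) list \<Rightarrow> nat set" where
  "fact_Des n w = perm_Des (n - 1) (edge_labeling n w)"

text \<open>A formal power series with integer coefficients in the variables \<open>x\<^sub>0, x\<^sub>1, x\<^sub>2, \<dots>\<close> is
  identified with its coefficient function; a monomial is the multiset of the indices of its
  variables. The first variable is thus called \<open>x\<^sub>0\<close> rather than \<open>x\<^sub>1\<close>; only the order of the
  variables matters.\<close>

type_synonym power_series = "nat multiset \<Rightarrow> int"

text \<open>The formal sum of the monomials \<open>wt a\<close> over \<open>a \<in> A\<close>; it is meaningful if every monomial
  occurs finitely often, see the finiteness lemmas below.\<close>

definition monomial_sum :: "'a set \<Rightarrow> ('a \<Rightarrow> nat multiset) \<Rightarrow> power_series" where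
  "monomial_sum A wt = (\<lambda>M. int (card {a \<in> A. wt a = M}))"

definition fundamental_seqs :: "nat \<Rightarrow> nat set \<Rightarrow> nat list set" where
  "fundamental_seqs m D =
     {s. length s = m \<and>
         (\<forall>j. 1 \<le> j \<and> j < m \<longrightarrow>
            s ! (j - 1) \<le> s ! j \<and> (j \<in> D \<longrightarrow> s ! (j - 1) < s ! j))}"

definition fundamental :: "nat \<Rightarrow> nat set \<Rightarrow> power_series" where
  "fundamental m D = monomial_sum (fundamental_seqs m D) mset"

definition is_partition :: "nat list \<Rightarrow> bool" where
  "is_partition la \<longleftrightarrow> sorted_wrt (\<ge>) la \<and> 0 \<notin> set la"

text \<open>Semistandard Young tableaux of shape \<open>la\<close>, given as the list of their rows.\<close>

definition ssyt :: "nat list \<Rightarrow> nat list list set" where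
  "ssyt la =
     {T. map length T = la \<and>
         (\<forall>r \<in> set T. sorted r) \<and>
         (\<forall>i j. i + 1 < length T \<and> j < length (T ! (i + 1)) \<longrightarrow> T ! i ! j < T ! (i + 1) ! j)}"

definition schur :: "nat list \<Rightarrow> power_series" where
  "schur la = monomial_sum (ssyt la) (\<lambda>T. mset (concat T))"

definition hook :: "nat \<Rightarrow> nat \<Rightarrow> nat list" where
  "hook a k = a # replicate k 1"

definition symmetric :: "power_series \<Rightarrow> bool" where
  "symmetric f \<longleftrightarrow> (\<forall>p M. bij p \<longrightarrow> f (image_mset p M) = f M)"

definition schur_expansion :: "power_series \<Rightarrow> (nat list \<Rightarrow> int) \<Rightarrow> bool" where
  "schur_expansion f c \<longleftrightarrow>
     finite {la. c la \<noteq> 0} \<and> (\<forall>la. c la \<noteq> 0 \<longrightarrow> is_partition la) \<and>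
     f = (\<lambda>M. \<Sum>la | c la \<noteq> 0. c la * schur la M)"

text \<open>The quasisymmetric function of a finite set \<open>A\<close> with a descent map into the subsets of
  \<open>{1..m - 1}\<close>.\<close>

definition quasi :: "nat \<Rightarrow> 'a set \<Rightarrow> ('a \<Rightarrow> nat set) \<Rightarrow> power_series" where
  "quasi m A Des = (\<lambda>M. \<Sum>a\<in>A. fundamental m (Des a) M)"

definition schur_positive :: "nat \<Rightarrow> 'a set \<Rightarrow> ('a \<Rightarrow> nat set) \<Rightarrow> bool" where
  "schur_positive m A Des \<longleftrightarrow>
     symmetric (quasi m A Des) \<and>
     (\<exists>c. schur_expansion (quasi m A Des) c \<and> (\<forall>la. c la \<ge> 0))"

lemma long_cycle_eq:
  assumes "n \<ge> 2"
  shows "long_cycle n i = (if 1 \<le> i \<and> i < n then i + 1 else if i = n then 1 else i)"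
proof -
  have *: "cycle_of_list [a..<Suc (a + d)] i =
      (if a \<le> i \<and> i < a + d then i + 1 else if i = a + d then a else i)" for a d
  proof (induction d arbitrary: a)
    case 0
    then show ?case by simp
  next
    case (Suc d)
    have e1: "[a..<Suc (a + Suc d)] = a # Suc a # [Suc (Suc a)..<Suc (a + Suc d)]"
      by (simp add: upt_conv_Cons)
    have e2: "Suc a # [Suc (Suc a)..<Suc (a + Suc d)] = [Suc a..<Suc (Suc a + d)]"
      by (simp add: upt_conv_Cons)
    have "cycle_of_list [a..<Suc (a + Suc d)] i =
        transpose a (Suc a) (cycle_of_list [Suc a..<Suc (Suc a + d)] i)"
      by (simp only: e1 cycle_of_list.simps o_apply) (simp only: e2)
    then show ?case
      unfolding Suc.IH by (auto simp: transpose_def)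
  qed
  show ?thesis
    using *[of 1 "n - 1"] assms unfolding long_cycle_def by auto
qed

lemma finite_factorizations: "finite (factorizations n)"
proof -
  have "transpositions n \<subseteq> (\<lambda>(a, b). transpose a b) ` ({1..n} \<times> {1..n})"
    unfolding transpositions_def by auto
  then have "finite (transpositions n)"
    by (rule finite_subset) simp
  then have "finite {w. set w \<subseteq> transpositions n \<and> length w = n - 1}"
    by (rule finite_lists_length_eq)
  then show ?thesis
    by (rule rev_finite_subset) (auto simp: factorizations_def)
qed

lemma finite_linear_factorizations: "finite (linear_factorizations n)"
  using finite_factorizations by (simp add: linear_factorizations_def)

lemma finite_fundamental_seqs: "finite {s \<in> fundamental_seqs m D. mset s = M}"
proof -
  have "finite {s. set s \<subseteq> set_mset M \<and> length s = m}"
    by (rule finite_lists_length_eq) simp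
  then show ?thesis
    by (rule rev_finite_subset) (auto simp: fundamental_seqs_def)
qed

lemma finite_ssyt: "finite {T \<in> ssyt la. mset (concat T) = M}"
proof -
  let ?R = "{r. set r \<subseteq> set_mset M \<and> length r \<le> sum_list la}"
  have "finite ?R"
    by (rule finite_lists_length_le) simp
  then have "finite {T. set T \<subseteq> ?R \<and> length T = length la}"
    by (rule finite_lists_length_eq)
  then show ?thesis
  proof (rule rev_finite_subset, intro subsetI)
    fix T assume "T \<in> {T \<in> ssyt la. mset (concat T) = M}"
    then have T: "map length T = la" "mset (concat T) = M"
      by (auto simp: ssyt_def)
    have "set r \<subseteq> set_mset M \<and> length r \<le> sum_list la" if "r \<in> set T" for r
    proof
      show "set r \<subseteq> set_mset M"
        using that T(2) by (metis UN_upper set_concat set_mset_mset)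
      have "length r \<in> set la"
        using that T(1) by auto
      then show "length r \<le> sum_list la"
        by (simp add: member_le_sum_list)
    qed
    moreover have "length T = length la"
      using T(1) by auto
    ultimately show "T \<in> {T. set T \<subseteq> ?R \<and> length T = length la}"
      by auto
  qed
qed

end

theory Submission
  imports Defs
begin

text \<open>
  The theorem reduces to one enumeration: for every \<open>D \<subseteq> {1..n - 2}\<close> exactly \<open>card D + 1\<close>
  linearly ordered factorizations of the long cycle have descent set \<open>D\<close>
  (\<open>card_linear_factorizations_with_descents\<close>). Indeed, the coefficient of a monomial \<open>M\<close> of
  degree \<open>n - 1\<close> in \<open>fundamental (n - 1) D\<close> is 1 if \<open>D\<close> lies in the set \<open>S\<close> of strict steps of
  the sorted list of indices of \<open>M\<close>, and 0 otherwise. So the coefficient in the quasisymmetric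
  function counts the factorizations with descent set inside \<open>S\<close>, and equals the sum of
  \<open>card D + 1\<close> over \<open>D \<subseteq> S\<close>, that is, the sum of \<open>(k + 1) * (card S choose k)\<close> over \<open>k\<close>. As
  \<open>card S\<close> is one less than the number of variables in \<open>M\<close>, this binomial coefficient is the
  number of hook tableaux with content \<open>M\<close>: such a tableau is determined by the entries of its
  column below the corner, an arbitrary \<open>k\<close>-subset of the non-minimal variables
  (\<open>schur_hook\<close>). This formula also shows that the hook Schur functions are symmetric.

  Linearly ordered factorizations have a rigid shape. If \<open>t\<^sub>1 \<dots> t\<^sub>k\<close> is a linearly ordered
  factorization of a cycle \<open>c\<close> on \<open>k + 1\<close> points, then \<open>t\<^sub>2, \<dots>, t\<^sub>k\<close> together involve at most
  \<open>k\<close> letters, so \<open>t\<^sub>1 c\<close> has to fix some point \<open>x\<close> of the cycle. Hence \<open>t\<^sub>1\<close> exchanges \<open>x\<close> and its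
  successor, and \<open>t\<^sub>2 \<dots> t\<^sub>k\<close> is a linearly ordered factorization of the cycle with \<open>x\<close> cut out.
  The common letter of \<open>t\<^sub>1\<close> and \<open>t\<^sub>2\<close> forces the next point that is cut out to be a neighbour
  of the gap left by \<open>x\<close>. Thus, after the free choice of the first point, the removed points form
  a cyclic interval that grows by one point at either end. Cutting the remaining circle open at
  the gap gives a list, and each step removes its first or its last entry
  (\<open>adjacent_words_step\<close>).

  The label of a step is the removed point, or, if that point is the largest one left, its cyclic
  predecessor. As long as there are points of \<open>{1..n - 1}\<close> left both below and above the removed
  ones, the next label is just below or just above all previous labels, so that each prescribed
  descent or ascent determines the step. Once the remaining points form an
  increasing list, the step at one end gives the smallest remaining label and the step at the
  other end the largest, so again the prescribed descents determine everything
  (\<open>card_words_increasing\<close>). Apart from the first point, a choice occurs only while every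
  remaining point but \<open>n\<close> is below the gap: removing \<open>n\<close> and removing the largest of the other
  points give the same label. The resulting recursion is \<open>gap_count\<close>; its sum over all first points increases by one with every
  prescribed descent and is unchanged by a prescribed ascent (\<open>sum_gap_count\<close>).
\<close>

section \<open>Linearly ordered factorizations of a cycle\<close>

definition linear_words :: "nat \<Rightarrow> nat list \<Rightarrow> (nat \<Rightarrow> nat) list set" where
  "linear_words n v =
     {w. length w = length v - 1 \<and> set w \<subseteq> transpositions n \<and>
         perm_prod w = cycle_of_list v \<and> linearly_ordered w}"

text \<open>The list \<open>v\<close> is a circle cut open at the gap left by the point removed last. The successor of
that point was \<open>hd v\<close>, so \<open>hd v\<close> is the letter that the next factor has to share with the
previous transposition, whose other letter has left the circle.\<close>

definition adjacent_words :: "nat \<Rightarrow> nat list \<Rightarrow> (nat \<Rightarrow> nat) list set" where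
  "adjacent_words n v = {w \<in> linear_words n v. w \<noteq> [] \<longrightarrow> hd v \<in> letters (hd w)}"

lemma perm_prod_simps [simp]: "perm_prod [] = id" "perm_prod (t # w) = t \<circ> perm_prod w"
  by (simp_all add: perm_prod_def)

lemma letters_transpose: "a \<noteq> b \<Longrightarrow> letters (transpose a b) = {a, b}"
  by (auto simp: letters_def transpose_def)

lemma transpositionsE:
  assumes "t \<in> transpositions n"
  obtains a b where "a \<in> {1..n}" "b \<in> {1..n}" "a \<noteq> b" "t = transpose a b"
  using assms by (auto simp: transpositions_def)

lemma linearly_ordered_Cons:
  "linearly_ordered (t # w) \<longleftrightarrow>
     linearly_ordered w \<and> (w \<noteq> [] \<longrightarrow> letters t \<inter> letters (hd w) \<noteq> {})"
proof (cases w)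
  case Nil
  then show ?thesis by (simp add: linearly_ordered_def)
next
  case (Cons t' w')
  have shift: "(\<forall>i. 1 \<le> i \<and> i < length (t # w) \<longrightarrow> P i) \<longleftrightarrow>
      P 1 \<and> (\<forall>i. 1 \<le> i \<and> i < length w \<longrightarrow> P (Suc i))" (is "?L \<longleftrightarrow> ?R")
    for P :: "nat \<Rightarrow> bool"
  proof
    assume ?L
    then show ?R using Cons by simp
  next
    assume R: ?R
    show ?L
    proof (intro allI impI)
      fix i assume "1 \<le> i \<and> i < length (t # w)"
      then obtain k where "i = Suc k" "k < length w"
        by (cases i) auto
      then show "P i"
        using R by (cases k) auto
    qed
  qed
  have nth: "(t # w) ! i = w ! (i - 1)" if "1 \<le> i" for i
    using that by (cases i) auto
  show ?thesis
    unfolding linearly_ordered_def shift using Cons by (simp add: nth Int_commute conj_commute)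
qed

text \<open>Each factor after the first adds at most one new letter, since it shares one with its neighbour.\<close>

lemma card_letters_le:
  assumes "linearly_ordered w" "set w \<subseteq> transpositions n"
  shows "finite (\<Union>t\<in>set w. letters t) \<and> card (\<Union>t\<in>set w. letters t) \<le> length w + 1"
  using assms
proof (induction w)
  case Nil
  then show ?case by simp
next
  case (Cons t w)
  let ?U = "\<Union>t\<in>set w. letters t"
  have IH: "finite ?U" "card ?U \<le> length w + 1"
    using Cons by (auto simp: linearly_ordered_Cons)
  from Cons.prems obtain a b where ab: "a \<noteq> b" "t = transpose a b"
    by (auto elim: transpositionsE)
  then have t: "letters t = {a, b}"
    by (simp add: letters_transpose)
  show ?case
  proof (cases "w = []")
    case True
    then show ?thesis using t by (simp add: card_insert_if)
  next
    case False
    then have "letters t \<inter> letters (hd w) \<noteq> {}"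
      using Cons.prems(1) by (simp add: linearly_ordered_Cons)
    moreover have "letters (hd w) \<subseteq> ?U"
      using False hd_in_set by blast
    ultimately obtain x where "x \<in> {a, b}" "x \<in> ?U"
      unfolding t by blast
    then have "\<exists>y. {a, b} \<union> ?U = insert y ?U"
      by auto
    then obtain y where "{a, b} \<union> ?U = insert y ?U" ..
    moreover have "card (insert y ?U) \<le> Suc (card ?U)"
      by (simp add: card_insert_le_m1 IH card_insert_if)
    ultimately show ?thesis
      using IH t by simp
  qed
qed

lemma perm_prod_moves:
  "perm_prod w y \<noteq> y \<Longrightarrow> y \<in> (\<Union>t\<in>set w. letters t)"
  by (induction w) (auto simp: letters_def, force)

lemma cycle_of_list_nth:
  assumes "distinct v" "k < length v"
  shows "cycle_of_list v (v ! k) = v ! (Suc k mod length v)"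
proof -
  have "map (cycle_of_list v) v ! k = rotate 1 v ! k"
    using cyclic_rotation[OF assms(1), of 1] by simp
  then show ?thesis
    using assms by (simp add: nth_rotate1)
qed

lemma cycle_of_list_moves:
  assumes "distinct v" "2 \<le> length v" "x \<in> set v"
  shows "cycle_of_list v x \<noteq> x" "cycle_of_list v x \<in> set v"
proof -
  obtain k where k: "k < length v" "x = v ! k"
    using assms(3) by (auto simp: in_set_conv_nth)
  have "0 < length v"
    using k by linarith
  have "Suc k mod length v \<noteq> k"
    using assms(2) k by (cases "Suc k = length v") auto
  then show "cycle_of_list v x \<noteq> x"
    using k assms nth_eq_iff_index_eq[OF assms(1), of "Suc k mod length v" k] \<open>0 < length v\<close>
    by (simp add: cycle_of_list_nth)
  have "v ! (Suc k mod length v) \<in> set v"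
    using \<open>0 < length v\<close> by (intro nth_mem mod_less_divisor)
  then show "cycle_of_list v x \<in> set v"
    using k assms(1) by (simp add: cycle_of_list_nth)
qed

text \<open>A counting argument: if the first factor \<open>t\<close> did not exchange a point and its image under
the cycle, then \<open>t\<close> times the cycle would move all points of the cycle, which are more than the
remaining factors have letters.\<close>

lemma first_factor:
  assumes "distinct v" "2 \<le> length v" "t # w \<in> linear_words n v"
  obtains x where "x \<in> set v" "t = transpose x (cycle_of_list v x)"
proof (rule ccontr)
  assume none: "\<not> thesis"
  note found = that
  let ?c = "cycle_of_list v"
  have w: "length w = length v - 2" "linearly_ordered w" "set w \<subseteq> transpositions n"
      "t \<in> transpositions n" "perm_prod (t # w) = ?c"
    using assms(3) by (auto simp: linear_words_def linearly_ordered_Cons)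
  obtain a b where ab: "a \<noteq> b" "t = transpose a b"
    using w(4) by (auto elim: transpositionsE)
  have moved: "perm_prod w y \<noteq> y" if y: "y \<in> set v" for y
  proof
    assume "perm_prod w y = y"
    then have "?c y = t y"
      using fun_cong[OF w(5), of y] by simp
    moreover have "?c y \<noteq> y"
      using cycle_of_list_moves[OF assms(1,2) y] by simp
    ultimately have "t = transpose y (?c y)"
      using ab by (auto simp: transpose_def fun_eq_iff split: if_splits)
    then show False
      using found[OF y] none by blast
  qed
  then have "set v \<subseteq> (\<Union>t\<in>set w. letters t)"
    using perm_prod_moves by blast
  then have "card (set v) \<le> length w + 1"
    using card_letters_le[OF w(2,3)] by (meson card_mono le_trans)
  then show False
    using assms(1,2) w(1) by (simp add: distinct_card)
qed

lemma letters_first_factor: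
  assumes "distinct v" "2 \<le> length v" "t # w \<in> linear_words n v"
  shows "letters t \<subseteq> set v"
proof -
  obtain x where x: "x \<in> set v" "t = transpose x (cycle_of_list v x)"
    using first_factor[OF assms] .
  then show ?thesis
    using cycle_of_list_moves[OF assms(1,2) x(1)] by (simp add: letters_transpose)
qed

text \<open>Cutting \<open>a\<close> out of the circle. The letters of the next factor lie on the smaller circle, so \<open>b\<close> is
the only letter that it can share with \<open>transpose a b\<close>; this turns the condition of
being linearly ordered into adjacency to the gap.\<close>

lemma linear_words_Cons_head:
  assumes v: "distinct (a # b # u)" "set (a # b # u) \<subseteq> {1..n}"
  shows "transpose a b # w \<in> linear_words n (a # b # u) \<longleftrightarrow> w \<in> adjacent_words n (b # u)"
proof -
  let ?t = "transpose a b" and ?c = "cycle_of_list (b # u)"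
  have t: "?t \<in> transpositions n" "letters ?t = {a, b}"
    using v by (auto simp: transpositions_def letters_transpose)
  have prod: "?t \<circ> perm_prod w = ?t \<circ> ?c \<longleftrightarrow> perm_prod w = ?c"
    by (metis comp_assoc transpose_comp_involutory id_comp)
  have meet: "letters ?t \<inter> letters (hd w) \<noteq> {} \<longleftrightarrow> b \<in> letters (hd w)"
    if w: "w \<noteq> []" "w \<in> linear_words n (b # u)"
  proof -
    have "2 \<le> length (b # u)"
      using w by (cases w) (auto simp: linear_words_def)
    then have "letters (hd w) \<subseteq> set (b # u)"
      using letters_first_factor[of "b # u" "hd w" "tl w" n] v w by simp
    then show ?thesis
      using v t by auto
  qed
  show ?thesis
  proof (cases "w \<in> linear_words n (b # u)")
    case True
    then show ?thesis
      using t meet prod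
      by (auto simp: linear_words_def adjacent_words_def linearly_ordered_Cons)
  next
    case False
    then show ?thesis
      using prod by (auto simp: linear_words_def adjacent_words_def linearly_ordered_Cons)
  qed
qed

lemma linear_words_rotate:
  "distinct v \<Longrightarrow> linear_words n (rotate k v) = linear_words n v"
  by (simp add: linear_words_def cycle_of_list_rotate_independent[symmetric])

text \<open>The first removed point \<open>v ! k\<close> is arbitrary; rotating it to the front leaves the rest of the
circle cut open at the gap.\<close>

lemma linear_words_decompose:
  assumes v: "distinct v" "2 \<le> length v" "set v \<subseteq> {1..n}"
  shows "linear_words n v =
    (\<Union>k<length v. (#) (transpose (v ! k) (v ! (Suc k mod length v))) `
                    adjacent_words n (tl (rotate k v)))"
proof -
  have rot: "\<exists>u. rotate k v = v ! k # v ! (Suc k mod length v) # u" if k: "k < length v" for k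
  proof -
    have "length (rotate k v) \<ge> 2"
      using v by simp
    then obtain a b u where abu: "rotate k v = a # b # u"
      by (metis One_nat_def Suc_1 Suc_le_length_iff)
    have "a = v ! (k mod length v)" "b = v ! (Suc k mod length v)"
      using nth_rotate[of 0 v k] nth_rotate[of 1 v k] v(2) by (cases "v = []"; simp add: abu)+
    then show ?thesis
      using k abu by simp
  qed
  have step: "transpose (v ! k) (v ! (Suc k mod length v)) # w \<in> linear_words n v \<longleftrightarrow>
      w \<in> adjacent_words n (tl (rotate k v))" if k: "k < length v" for k w
  proof -
    obtain u where u: "rotate k v = v ! k # v ! (Suc k mod length v) # u"
      using rot[OF k] ..
    have "distinct (rotate k v)" "set (rotate k v) \<subseteq> {1..n}"
      using v by simp_all
    then show ?thesis
      using linear_words_Cons_head[of "v ! k" "v ! (Suc k mod length v)" u n w]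
        linear_words_rotate[OF v(1), of n k] by (simp add: u)
  qed
  show ?thesis
  proof (intro equalityI subsetI)
    fix w0 assume w0: "w0 \<in> linear_words n v"
    then obtain t w where tw: "w0 = t # w"
      using v(2) by (cases w0) (auto simp: linear_words_def)
    obtain x where x: "x \<in> set v" "t = transpose x (cycle_of_list v x)"
      using first_factor[OF v(1,2)] w0 tw by blast
    then obtain k where "k < length v" "x = v ! k"
      by (auto simp: in_set_conv_nth)
    then show "w0 \<in> (\<Union>k<length v. (#) (transpose (v ! k) (v ! (Suc k mod length v))) `
                    adjacent_words n (tl (rotate k v)))"
      using step w0 x v tw by (auto simp: cycle_of_list_nth)
  qed (use step in auto)
qed

lemma adjacent_words_single: "adjacent_words n [a] = {[]}"
  by (auto simp: adjacent_words_def linear_words_def linearly_ordered_def perm_prod_def)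

text \<open>Among the first factors in \<open>linear_words_decompose\<close>, those containing \<open>a = hd v\<close> belong to
the removal of \<open>a\<close> itself or of its cyclic predecessor, the last entry of the list.\<close>

lemma adjacent_words_step:
  assumes v: "distinct (a # b # u)" "set (a # b # u) \<subseteq> {1..n}"
  shows "adjacent_words n (a # b # u) =
    (#) (transpose a b) ` adjacent_words n (b # u) \<union>
    (#) (transpose (last (b # u)) a) ` adjacent_words n (butlast (a # b # u))"
proof -
  let ?v = "a # b # u"
  let ?t = "\<lambda>k. transpose (?v ! k) (?v ! (Suc k mod length ?v))"
  have "\<And>k. k < length ?v \<Longrightarrow> ?v ! k \<noteq> ?v ! (Suc k mod length ?v)"
    using cycle_of_list_moves(1)[of ?v] v
    by (metis cycle_of_list_nth length_Cons nth_mem le_add2 add_2_eq_Suc')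
  then have letters_t: "letters (?t k) = {?v ! k, ?v ! (Suc k mod length ?v)}" if "k < length ?v" for k
    using that letters_transpose by blast
  have a: "a \<in> letters (?t k) \<longleftrightarrow> k = 0 \<or> k = Suc (length u)" if k: "k < length ?v" for k
  proof -
    have "a = ?v ! i \<longleftrightarrow> i = 0" if "i < length ?v" for i
      using nth_eq_iff_index_eq[OF v(1), of 0 i] that by auto
    from this[of k] this[of "Suc k mod length ?v"] have
      "a \<in> letters (?t k) \<longleftrightarrow> k = 0 \<or> Suc k mod length ?v = 0"
      unfolding letters_t[OF k] using k by auto
    also have "\<dots> \<longleftrightarrow> k = 0 \<or> k = Suc (length u)"
      using k by (cases "Suc k = length ?v") auto
    finally show ?thesis .
  qed
  \<comment> \<open>the rotation that brings the last entry to the front\<close>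
  have rot: "rotate (Suc (length u)) ?v = last (b # u) # butlast ?v"
    using rotate_append[of "butlast ?v" "[last ?v]"]
    by (metis append_Cons append_Nil append_butlast_last_id diff_Suc_1 last_ConsR length_Cons
        length_butlast list.distinct(1))
  have "adjacent_words n ?v = {w \<in> linear_words n ?v. a \<in> letters (hd w)}"
    by (auto simp: adjacent_words_def linear_words_def)
  also have "\<dots> = (\<Union>k\<in>{k. k < length ?v \<and> a \<in> letters (?t k)}.
                  (#) (?t k) ` adjacent_words n (tl (rotate k ?v)))"
    by (subst linear_words_decompose[OF v(1) _ v(2)]) auto
  also have "{k. k < length ?v \<and> a \<in> letters (?t k)} = {0, Suc (length u)}"
    using a by auto
  finally show ?thesis
    using rot by (simp add: last_conv_nth)
qed

section \<open>Labels\<close>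

text \<open>The edge labeling as a list, computed from the tails of the factorization: the tail product is
the partial product of the following index.\<close>

fun labels :: "nat \<Rightarrow> (nat \<Rightarrow> nat) list \<Rightarrow> nat list" where
  "labels n [] = []"
| "labels n (t # w) =
     the_elem {i \<in> {1..n - 1}. perm_prod (t # w) i > perm_prod w i} # labels n w"

text \<open>Descent sets are encoded as lists of truth values because the counts below recurse on the first
position.\<close>

fun descent_word :: "nat list \<Rightarrow> bool list" where
  "descent_word (x # y # xs) = (x > y) # descent_word (y # xs)"
| "descent_word _ = []"

lemma length_labels [simp]: "length (labels n w) = length w"
  by (induction w) auto

lemma length_descent_word [simp]: "length (descent_word xs) = length xs - 1"
  by (induction xs rule: descent_word.induct) auto

text \<open>The cycles before and after cutting out \<open>a\<close> differ only at \<open>a\<close> (with images \<open>b\<close> and \<open>a\<close>) and at the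
predecessor of \<open>a\<close> (with images \<open>a\<close> and \<open>b\<close>), so the label depends only on how \<open>a\<close> and \<open>b\<close>
compare. In the circles that occur, \<open>a > b\<close> means that \<open>a\<close> is the largest point;
the hypothesis \<open>last (b # u) < a\<close> keeps the label below \<open>n\<close>.\<close>

lemma label_of_removed_letter:
  fixes n :: nat
  assumes v: "distinct (a # b # u)" "set (a # b # u) \<subseteq> {1..n}"
    and max: "a < b \<or> last (b # u) < a"
  shows "{i \<in> {1..n - 1}. cycle_of_list (a # b # u) i > cycle_of_list (b # u) i} =
         {if a < b then a else last (b # u)}"
proof -
  let ?c = "cycle_of_list (b # u)" and ?z = "last (b # u)"
  have inj: "?c i = ?c j \<longleftrightarrow> i = j" for i j
    using cycle_permutes[of "b # u"] by (metis permutes_inj inj_eq)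
  have z: "?c ?z = b"
    using cycle_of_list_nth[of "b # u" "length u"] v last_conv_nth[of "b # u"]
    by (simp del: cycle_of_list.simps last.simps)
  have a: "?c a = a"
    using v by (intro id_outside_supp) simp
  have "?c i = b \<longleftrightarrow> i = ?z" "?c i = a \<longleftrightarrow> i = a" for i
    using inj[of i ?z] inj[of i a] by (simp_all only: z a)
  moreover have "?z \<noteq> a"
    using v(1) last_in_set[of "b # u"] by auto
  ultimately have
    "cycle_of_list (a # b # u) i = (if i = a then b else if i = ?z then a else ?c i)" for i
    using a z by (auto simp: transpose_def simp del: last.simps)
  then have "cycle_of_list (a # b # u) i > ?c i \<longleftrightarrow> i = a \<and> a < b \<or> i = ?z \<and> b < a" for i
    using a z \<open>?z \<noteq> a\<close> by (simp del: last.simps cycle_of_list.simps)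
  moreover have "?z \<in> set (b # u)"
    by (rule last_in_set) simp
  then have "?z \<in> {1..n}" "?z < a \<Longrightarrow> ?z < n"
    using v by auto
  moreover have "a \<noteq> b" "a < b \<Longrightarrow> a < n" "1 \<le> a"
    using v by auto
  ultimately show ?thesis
    using max by (auto simp del: cycle_of_list.simps last.simps)
qed

lemma labels_Cons:
  assumes "distinct (a # b # u)" "set (a # b # u) \<subseteq> {1..n}" "a < b \<or> last (b # u) < a"
    and "w \<in> adjacent_words n (b # u)"
  shows "labels n (transpose a b # w) = (if a < b then a else last (b # u)) # labels n w"
proof -
  have w: "perm_prod w = cycle_of_list (b # u)"
    using assms(4) by (simp add: adjacent_words_def linear_words_def)
  then have "perm_prod (transpose a b # w) = cycle_of_list (a # b # u)"
    by simp
  then show ?thesis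
    using label_of_removed_letter[OF assms(1-3)] w
    by (simp del: cycle_of_list.simps last.simps perm_prod_simps)
qed

text \<open>The previous label \<open>p\<close> is part of the data, so that the descent between \<open>p\<close> and the first label of
the word is prescribed as well.\<close>

definition words_with_descents ::
    "nat \<Rightarrow> nat list \<Rightarrow> nat \<Rightarrow> bool list \<Rightarrow> (nat \<Rightarrow> nat) list set" where
  "words_with_descents n v p bs =
     {w \<in> adjacent_words n v. descent_word (p # labels n w) = bs}"

lemma words_with_descents_single: "words_with_descents n [a] p [] = {[]}"
  by (auto simp: words_with_descents_def adjacent_words_single)

lemma finite_words_with_descents: "finite (words_with_descents n v p bs)"
proof (rule finite_subset)
  show "words_with_descents n v p bs \<subseteq> {w. set w \<subseteq> transpositions n \<and> length w = length v - 1}"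
    by (auto simp: words_with_descents_def adjacent_words_def linear_words_def)
  have "transpositions n \<subseteq> (\<lambda>(a, b). transpose a b) ` ({1..n} \<times> {1..n})"
    unfolding transpositions_def by auto
  then have "finite (transpositions n)"
    by (rule finite_subset) simp
  then show "finite {w. set w \<subseteq> transpositions n \<and> length w = length v - 1}"
    by (rule finite_lists_length_eq)
qed

lemma words_with_descents_step:
  assumes v: "distinct (a # b # u)" "set (a # b # u) \<subseteq> {1..n}"
    and max_first: "a < b \<or> last (b # u) < a"
    and max_last: "last (b # u) < a \<or> last (butlast (a # b # u)) < last (b # u)"
  defines "x \<equiv> if a < b then a else last (b # u)"
    and "y \<equiv> if last (b # u) < a then last (b # u) else last (butlast (a # b # u))"
  shows "words_with_descents n (a # b # u) p (c # bs) =
    {w \<in> (#) (transpose a b) ` words_with_descents n (b # u) x bs. c = (p > x)} \<union>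
    {w \<in> (#) (transpose (last (b # u)) a) ` words_with_descents n (butlast (a # b # u)) y bs.
       c = (p > y)}"
proof -
  define u' where "u' = butlast (b # u)"
  then have u': "butlast (a # b # u) = a # u'"
    by (simp add: u'_def)
  let ?z = "last (b # u)"
  have vz: "?z # a # u' = ?z # butlast (a # b # u)"
    by (simp only: u')
  have "mset (a # b # u) = mset (?z # a # u')"
    unfolding vz by (metis append_butlast_last_id last_ConsR list.distinct(1) mset_append
        mset.simps(1,2) add_mset_add_single)
  then have z: "distinct (?z # a # u')" "set (?z # a # u') \<subseteq> {1..n}"
    using v mset_eq_imp_distinct_iff mset_eq_setD by blast+
  have 1: "labels n (transpose a b # w) = x # labels n w" if "w \<in> adjacent_words n (b # u)" for w
    unfolding x_def using v max_first that by (rule labels_Cons)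
  have 2: "labels n (transpose ?z a # w) = y # labels n w"
    if w: "w \<in> adjacent_words n (butlast (a # b # u))" for w
    unfolding y_def u' using z max_last w unfolding u' by (rule labels_Cons)
  show ?thesis
    unfolding words_with_descents_def adjacent_words_step[OF v]
    by (auto simp: 1 2 simp del: butlast.simps last.simps labels.simps)
qed

text \<open>A circle of two points is the exception in the recursion: removing either point is the same
transposition, so the two branches coincide.\<close>

lemma card_words_two:
  assumes "{a, b} \<subseteq> {1..n}" "a \<noteq> b"
  shows "card (words_with_descents n [a, b] p [c]) = of_bool (c = (p > min a b))"
  using assms words_with_descents_step[of a b "[]" n p c "[]"]
  by (auto simp: words_with_descents_single transpose_commute min_def)

lemma card_words_step:
  assumes v: "distinct (a # b # u)" "set (a # b # u) \<subseteq> {1..n}" and u: "u \<noteq> []"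
    and max_first: "a < b \<or> last (b # u) < a"
    and max_last: "last (b # u) < a \<or> last (butlast (a # b # u)) < last (b # u)"
  defines "x \<equiv> if a < b then a else last (b # u)"
    and "y \<equiv> if last (b # u) < a then last (b # u) else last (butlast (a # b # u))"
  shows "card (words_with_descents n (a # b # u) p (c # bs)) =
    of_bool (c = (p > x)) * card (words_with_descents n (b # u) x bs) +
    of_bool (c = (p > y)) * card (words_with_descents n (butlast (a # b # u)) y bs)"
proof -
  let ?t = "transpose a b" and ?t' = "transpose (last (b # u)) a"
  \<comment> \<open>with at least three points on the circle the two possible first factors are different\<close>
  have "last (b # u) \<in> set u"
    using u by simp
  then have "last (b # u) \<noteq> a" "last (b # u) \<noteq> b" "a \<noteq> b"
    using v by auto
  then have "letters ?t \<noteq> letters ?t'"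
    by (metis letters_transpose doubleton_eq_iff)
  then have "?t \<noteq> ?t'"
    by auto
  then have disj: "(#) ?t ` X \<inter> (#) ?t' ` Y = {}" for X Y
    by auto
  have card: "card {w \<in> (#) t ` X. P} = of_bool P * card X" for t X P
    by (cases P) (simp_all add: card_image)
  have "card (words_with_descents n (a # b # u) p (c # bs)) =
    card {w \<in> (#) ?t ` words_with_descents n (b # u) x bs. c = (p > x)} +
    card {w \<in> (#) ?t' ` words_with_descents n (butlast (a # b # u)) y bs. c = (p > y)}"
    unfolding words_with_descents_step[OF v max_first max_last, of p c bs, folded x_def y_def]
  proof (rule card_Un_disjoint)
    show "{w \<in> (#) ?t ` words_with_descents n (b # u) x bs. c = (p > x)} \<inter>
        {w \<in> (#) ?t' ` words_with_descents n (butlast (a # b # u)) y bs. c = (p > y)} = {}"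
      using disj by blast
  qed (simp_all add: finite_words_with_descents)
  then show ?thesis
    by (simp only: card)
qed

definition starts_with :: "bool \<Rightarrow> bool list \<Rightarrow> bool" where
  "starts_with c bs \<longleftrightarrow> bs \<noteq> [] \<and> hd bs = c"

lemma starts_with_simps [simp]: "\<not> starts_with c []" "starts_with c (d # bs) \<longleftrightarrow> d = c"
  by (auto simp: starts_with_def)

lemma less_last_if_sorted:
  "sorted_wrt (<) xs \<Longrightarrow> x \<in> set (butlast xs) \<Longrightarrow> x < last xs"
  by (cases xs rule: rev_cases) (auto simp: sorted_wrt_append)

text \<open>On an increasing list the labels are the entries except the largest one. Removing the first entry
gives the smallest of them as label, so that an ascent follows; removing the last entry gives the
largest, so that a descent follows. Hence all descents but the first can be prescribed freely and
then determine the word; the first is forced, because \<open>p\<close> lies below or above all labels.\<close>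

lemma card_words_increasing:
  assumes "sorted_wrt (<) v" "set v \<subseteq> {1..n}" "length v = Suc (length bs)"
  shows "p < hd v \<Longrightarrow> card (words_with_descents n v p bs) = of_bool (\<not> starts_with True bs)"
    and "(\<And>x. x \<in> set (butlast v) \<Longrightarrow> x < p) \<Longrightarrow>
           card (words_with_descents n v p bs) = of_bool (\<not> starts_with False bs)"
  using assms
proof (induction bs arbitrary: v p)
  case Nil
  {
    case 1
    then show ?case by (auto simp: length_Suc_conv words_with_descents_single)
  next
    case 2
    then show ?case by (auto simp: length_Suc_conv words_with_descents_single)
  }
next
  case (Cons c bs)
  \<comment> \<open>\<open>d\<close> tells on which side of the labels the previous label \<open>p\<close> lies\<close>
  have main: "card (words_with_descents n v p (c # bs)) = of_bool (c = d)"
    if v: "sorted_wrt (<) v" "set v \<subseteq> {1..n}" "length v = Suc (length (c # bs))"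
      and p: "if d then \<forall>x \<in> set (butlast v). x < p else p < hd v" for v p d
  proof -
    obtain a b u where abu: "v = a # b # u"
      using v(3) by (auto simp: length_Suc_conv)
    show ?thesis
    proof (cases "u = []")
      case True
      then have "bs = []"
        using v(3) abu by simp
      then show ?thesis
        using card_words_two[of a b n p c] v p abu True by (auto split: if_splits)
    next
      case False
      let ?y = "last (butlast v)"
      obtain u' z where v': "v = a # b # u' @ [z]" and z: "z = last (b # u)"
        using abu False by (cases u rule: rev_cases) auto
      then have bl: "butlast v = a # b # u'"
        by simp
      have dist: "distinct v"
        using v(1) strict_sorted_iff by blast
      have sb: "sorted_wrt (<) (butlast v)"
        using v(1) unfolding bl v' by (simp add: sorted_wrt_append)
      have "?y \<in> set (b # u')"
        unfolding bl by (simp add: last_in_set)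
      then have ord: "a < b" "a < z" "?y < z" "a < ?y"
        using v(1) unfolding v' by (auto simp: sorted_wrt_append)
      have "card (words_with_descents n v p (c # bs)) =
          of_bool (c = (p > a)) * card (words_with_descents n (b # u) a bs) +
          of_bool (c = (p > ?y)) * card (words_with_descents n (butlast v) ?y bs)"
        using card_words_step[of a b u n p c bs] dist v(2) False ord
        unfolding abu z by (simp del: butlast.simps last.simps)
      moreover have "card (words_with_descents n (b # u) a bs) = of_bool (\<not> starts_with True bs)"
        using v abu ord by (intro Cons.IH(1)) auto
      moreover have "card (words_with_descents n (butlast v) ?y bs)
          = of_bool (\<not> starts_with False bs)"
      proof (rule Cons.IH(2))
        show "set (butlast v) \<subseteq> {1..n}"
          using v(2) by (meson in_set_butlastD subset_iff)
        show "x < ?y" if "x \<in> set (butlast (butlast v))" for x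
          using less_last_if_sorted[OF sb that] .
      qed (use sb v(3) in auto)
      moreover have "(p > a) = d" "(p > ?y) = d"
      proof -
        have "a \<in> set (butlast v)" "?y \<in> set (butlast v)"
          unfolding bl by (simp_all add: last_in_set)
        then show "(p > a) = d" "(p > ?y) = d"
          using p abu ord by (auto split: if_splits simp del: butlast.simps last.simps)
      qed
      ultimately show ?thesis
        using v(3) abu False by (cases bs) auto
    qed
  qed
  {
    case 1
    then show ?case using main[where v = v and p = p and d = False] by simp
  next
    case 2
    then show ?case using main[where v = v and p = p and d = True] by simp
  }
qed

section \<open>Counting factorizations with prescribed descents\<close>

text \<open>The first two arguments are the numbers of labels left below and above the gap. In the second
equation no label is left above the gap, only the largest point \<open>z\<close> of the circle. The next label
is then the largest one below the gap, and it arises both by removing that point and by removing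
\<open>z\<close>. The latter leaves an increasing list below the label, which has one completion if a
descent is prescribed next. For the last point (\<open>j = 0\<close>) the two removals coincide, and the added
term vanishes, as \<open>bs\<close> is then empty. The last equation is a default value: \<open>bs\<close> has one entry for
every label that is left.\<close>

fun gap_count :: "nat \<Rightarrow> nat \<Rightarrow> bool list \<Rightarrow> nat" where
  "gap_count 0 k bs = of_bool (\<not> starts_with True bs)"
| "gap_count (Suc j) 0 (c # bs) = (if c then gap_count j 0 bs + of_bool (starts_with True bs) else 0)"
| "gap_count (Suc j) (Suc k) (c # bs) =
     (if c then gap_count j (Suc k) bs else gap_count (Suc j) k bs)"
| "gap_count (Suc j) k [] = 0"

text \<open>The circle has the points \<open>ls\<close> below and \<open>hs\<close> above the gap, and \<open>p\<close> was removed last. Read from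
the gap onwards it is \<open>hs @ ls\<close>. The list \<open>hs\<close> ends in the largest point, which is not a label.\<close>

lemma card_words_gap:
  assumes "sorted_wrt (<) (ls @ p # hs)" "set (ls @ p # hs) \<subseteq> {1..n}" "hs \<noteq> []"
    and "length hs + length ls = Suc (length bs)"
  shows "card (words_with_descents n (hs @ ls) p bs) =
         gap_count (length ls) (length hs - 1) bs"
  using assms
proof (induction bs arbitrary: ls p hs)
  case Nil
  then show ?case
    by (cases hs) (auto simp: words_with_descents_single)
next
  case (Cons c bs)
  show ?case
  proof (cases ls rule: rev_cases)
    case Nil
    then show ?thesis
      using Cons.prems card_words_increasing(1)[of hs n "c # bs" p]
      by (cases hs) auto
  next
    case (snoc ls' l)
    obtain h hs' where hs: "hs = h # hs'"
      using Cons.prems(3) by (cases hs) auto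
    have ord: "sorted_wrt (<) (ls' @ l # p # h # hs')" "set (ls' @ l # p # h # hs') \<subseteq> {1..n}"
      using Cons.prems snoc hs by auto
    then have lh: "l < p" "p < h" "l < h"
      by (auto simp: sorted_wrt_append)
    have dist: "distinct (hs @ ls)"
    proof -
      have "distinct (ls @ p # hs)"
        using Cons.prems(1) strict_sorted_iff by blast
      then show ?thesis by auto
    qed
    have sub: "set (hs @ ls) \<subseteq> {1..n}"
      using Cons.prems(2) by auto
    show ?thesis
    proof (cases hs')
      \<comment> \<open>Two points above the gap: an ascent removes \<open>h\<close>, a descent removes \<open>l\<close>.\<close>
      case (Cons h2 hs'')
      have h: "h < h2"
        using ord Cons by (auto simp: sorted_wrt_append)
      have "card (words_with_descents n (hs @ ls) p (c # bs)) =
          of_bool (c = (p > h)) * card (words_with_descents n ((h2 # hs'') @ ls) h bs) +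
          of_bool (c = (p > l)) * card (words_with_descents n ((h # h2 # hs'') @ ls') l bs)"
        using card_words_step[of h h2 "hs'' @ ls" n p c bs] dist sub h lh hs Cons snoc
        by (simp add: butlast_append)
      moreover have "card (words_with_descents n ((h2 # hs'') @ ls) h bs) =
          gap_count (length ls) (length (h2 # hs'') - 1) bs"
        using ord Cons.prems(4) hs Cons snoc by (intro Cons.IH) (auto simp: sorted_wrt_append)
      moreover have "card (words_with_descents n ((h # h2 # hs'') @ ls') l bs) =
          gap_count (length ls') (length (h # h2 # hs'') - 1) bs"
        using ord Cons.prems(4) hs Cons snoc by (intro Cons.IH) (auto simp: sorted_wrt_append)
      ultimately show ?thesis
        using lh hs Cons snoc by auto
    next
      \<comment> \<open>Only the largest point \<open>h\<close> is above the gap: removing \<open>h\<close> or \<open>l\<close> gives the label \<open>l\<close>.\<close>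
      case Nil
      show ?thesis
      proof (cases ls')
        case Nil
        then have "bs = []"
          using Cons.prems(4) hs snoc \<open>hs' = []\<close> by simp
        then show ?thesis
          using card_words_two[of h l n p c] sub lh hs snoc \<open>hs' = []\<close> Nil by auto
      next
        case (Cons l1 ls'')
        have l1: "l1 < h" "\<And>x. x \<in> set ls' \<Longrightarrow> x < l"
          using ord Cons by (auto simp: sorted_wrt_append)
        have "card (words_with_descents n (hs @ ls) p (c # bs)) =
            of_bool (c = (p > l)) * card (words_with_descents n ls l bs) +
            of_bool (c = (p > l)) * card (words_with_descents n (hs @ ls') l bs)"
          using card_words_step[of h l1 "ls'' @ [l]" n p c bs] dist sub lh l1(1) hs Cons snoc
            \<open>hs' = []\<close>
          by (simp add: butlast_append)
        moreover have "card (words_with_descents n (hs @ ls') l bs) =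
            gap_count (length ls') (length hs - 1) bs"
          using ord Cons.prems(4) hs Cons snoc by (intro Cons.IH) (auto simp: sorted_wrt_append)
        moreover have "card (words_with_descents n ls l bs) = of_bool (\<not> starts_with False bs)"
          using ord sub Cons.prems(4) hs snoc \<open>hs' = []\<close> l1(2)
          by (intro card_words_increasing(2)) (auto simp: sorted_wrt_append)
        moreover have "bs \<noteq> []"
          using Cons.prems(4) hs snoc Cons by auto
        ultimately show ?thesis
          using lh hs snoc \<open>hs' = []\<close> by (cases bs) auto
      qed
    qed
  qed
qed

text \<open>Summing over the possible first labels makes the recursion collapse. The
summand \<open>starts_with True bs\<close> accounts for the factorizations that remove \<open>n\<close> first. If an ascent
is put in front of \<open>bs\<close>, the term with no label below the gap becomes 1, which absorbs exactly
this summand, and the other terms stay the same. If a descent is put in front, the second equation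
of \<open>gap_count\<close> supplies the summand, and removing \<open>n\<close> first contributes one more.\<close>

lemma sum_gap_count:
  "(\<Sum>j\<le>length bs. gap_count j (length bs - j) bs) + of_bool (starts_with True bs) =
     Suc (length (filter id bs))"
proof (induction bs)
  case Nil
  then show ?case by simp
next
  case (Cons c bs)
  let ?m = "length bs"
  have "(\<Sum>j\<le>Suc ?m. gap_count j (Suc ?m - j) (c # bs)) =
      gap_count 0 (Suc ?m) (c # bs) + (\<Sum>j\<le>?m. gap_count (Suc j) (?m - j) (c # bs))"
    by (subst sum.atMost_Suc_shift) simp
  also have "\<dots> + of_bool (starts_with True (c # bs)) =
      (\<Sum>j\<le>?m. gap_count j (?m - j) bs) + of_bool (starts_with True bs) + of_bool c"
  proof (cases c)
    case True
    have "(\<Sum>j\<le>?m. gap_count (Suc j) (?m - j) (c # bs)) =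
        (\<Sum>j<?m. gap_count j (?m - j) bs) + gap_count ?m 0 bs + of_bool (starts_with True bs)"
    proof -
      have "(\<Sum>j<?m. gap_count (Suc j) (?m - j) (c # bs)) = (\<Sum>j<?m. gap_count j (?m - j) bs)"
      proof (rule sum.cong)
        fix j assume "j \<in> {..<?m}"
        then have "?m - j = Suc (?m - Suc j)" by auto
        then show "gap_count (Suc j) (?m - j) (c # bs) = gap_count j (?m - j) bs"
          using True by simp
      qed simp
      then show ?thesis
        using True by (simp add: lessThan_Suc_atMost[symmetric])
    qed
    then show ?thesis
      using True by (simp add: lessThan_Suc_atMost[symmetric])
  next
    case False
    have "(\<Sum>j\<le>?m. gap_count (Suc j) (?m - j) (c # bs)) =
        (\<Sum>j<?m. gap_count (Suc j) (?m - Suc j) bs)"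
    proof -
      have "(\<Sum>j<?m. gap_count (Suc j) (?m - j) (c # bs)) =
          (\<Sum>j<?m. gap_count (Suc j) (?m - Suc j) bs)"
      proof (rule sum.cong)
        fix j assume "j \<in> {..<?m}"
        then have "?m - j = Suc (?m - Suc j)" by auto
        then show "gap_count (Suc j) (?m - j) (c # bs) = gap_count (Suc j) (?m - Suc j) bs"
          using False by simp
      qed simp
      then show ?thesis
        using False by (simp add: lessThan_Suc_atMost[symmetric])
    qed
    moreover have "(\<Sum>j\<le>?m. gap_count j (?m - j) bs) =
        gap_count 0 ?m bs + (\<Sum>j<?m. gap_count (Suc j) (?m - Suc j) bs)"
      using sum.lessThan_Suc_shift[of "\<lambda>j. gap_count j (?m - j) bs" ?m]
      by (simp only: lessThan_Suc_atMost diff_zero)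
    ultimately show ?thesis
      using False by simp
  qed
  finally show ?case
    using Cons by simp
qed

lemma rotate_interval: "k \<le> n \<Longrightarrow> rotate k [1..<Suc n] = [Suc k..<Suc n] @ [1..<Suc k]"
  by (cases "k = n") (simp_all add: rotate_drop_take take_upt drop_upt del: upt_Suc)

text \<open>A first point \<open>k + 1 < n\<close> has label \<open>k + 1\<close> and leaves \<open>k\<close> points below the gap; the first point \<open>n\<close>
has label \<open>n - 1\<close> and leaves an increasing list. For \<open>n = 2\<close> both first points yield the
same factorization.\<close>

lemma card_linear_words_with_descents:
  assumes n: "2 \<le> n" and bs: "length bs = n - 2"
  shows "card {w \<in> linear_words n [1..<Suc n]. descent_word (labels n w) = bs} =
    Suc (length (filter id bs))"
proof -
  let ?v = "[1..<Suc n]"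
  define t :: "nat \<Rightarrow> nat \<Rightarrow> nat"
    where "t k = (if Suc k < n then transpose (Suc k) (Suc (Suc k)) else transpose n 1)" for k
  define x where "x k = (if Suc k < n then Suc k else n - 1)" for k
  define X where "X k = words_with_descents n (tl (rotate k ?v)) (x k) bs" for k
  have t_nth: "transpose (?v ! k) (?v ! (Suc k mod length ?v)) = t k" if "k < n" for k
    using that n by (cases "Suc k = n") (auto simp: t_def simp del: upt_Suc)
  have rot_small: "rotate k ?v = Suc k # Suc (Suc k) # [Suc (Suc (Suc k))..<Suc n] @ [1..<Suc k]"
    if "Suc k < n" for k
    using that rotate_interval[of k n] by (simp add: upt_conv_Cons del: upt_Suc)
  have rot_top: "rotate (n - 1) ?v = n # 1 # [2..<n]"
    using n rotate_interval[of "n - 1" n] by (simp add: upt_conv_Cons numeral_2_eq_2 del: upt_Suc)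
  have labels_t: "labels n (t k # w) = x k # labels n w"
    if k: "k < n" and w: "w \<in> adjacent_words n (tl (rotate k ?v))" for k w
  proof -
    have dist: "distinct (rotate k ?v)" "set (rotate k ?v) \<subseteq> {1..n}"
      by (auto simp del: upt_Suc)
    show ?thesis
    proof (cases "Suc k < n")
      case True
      show ?thesis
        using labels_Cons[of "Suc k" "Suc (Suc k)" "[Suc (Suc (Suc k))..<Suc n] @ [1..<Suc k]" n w] dist w True
        unfolding rot_small[OF True] by (simp add: t_def x_def del: labels.simps upt_Suc)
    next
      case False
      then have "k = n - 1"
        using k by simp
      moreover have "last (1 # [2..<n]) = n - 1"
        using n by (auto simp: last_conv_nth)
      moreover have "{2..<n} \<subseteq> {1..n}"
        by auto
      ultimately show ?thesis
        using labels_Cons[of n 1 "[2..<n]" n w] w n rot_top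
        by (simp add: t_def x_def del: labels.simps upt_Suc last.simps)
    qed
  qed
  have split: "{w \<in> linear_words n ?v. descent_word (labels n w) = bs} =
      (\<Union>k<n. (#) (t k) ` X k)"
  proof -
    have decompose:
      "linear_words n ?v = (\<Union>k<n. (#) (t k) ` adjacent_words n (tl (rotate k ?v)))"
    proof -
      have "set ?v \<subseteq> {1..n}" "distinct ?v" "length ?v = n"
        by (auto simp del: upt_Suc)
      then show ?thesis
        using linear_words_decompose[of ?v n] n t_nth by (simp del: upt_Suc)
    qed
    have Collect_UN: "{w \<in> (\<Union>k<n. A k). P w} = (\<Union>k<n. {w \<in> A k. P w})"
      for A :: "nat \<Rightarrow> (nat \<Rightarrow> nat) list set" and P
      by blast
    show ?thesis
      unfolding decompose Collect_UN
    proof (rule SUP_cong[OF refl])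
      fix k assume "k \<in> {..<n}"
      then have "labels n (t k # w) = x k # labels n w"
        if "w \<in> adjacent_words n (tl (rotate k ?v))" for w
        using labels_t that by blast
      then show "{w \<in> (#) (t k) ` adjacent_words n (tl (rotate k ?v)).
          descent_word (labels n w) = bs} = (#) (t k) ` X k"
        unfolding Compr_image_eq X_def words_with_descents_def
        by (intro image_cong Collect_cong) auto
    qed
  qed
  have card_small: "card (X k) = gap_count k (n - 2 - k) bs" if k: "Suc k < n" for k
  proof -
    have "tl (rotate k ?v) = [Suc (Suc k)..<Suc n] @ [1..<Suc k]" "x k = Suc k"
      using k rot_small[OF k] by (simp_all add: x_def upt_conv_Cons del: upt_Suc)
    moreover have "[1..<Suc k] @ Suc k # [Suc (Suc k)..<Suc n] = ?v"
      using k upt_add_eq_append[of 1 "Suc k" "n - k"] upt_conv_Cons[of "Suc k" "Suc n"]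
      by (simp del: upt_Suc)
    moreover have "sorted_wrt (<) ?v" "set ?v \<subseteq> {1..n}"
      by (auto simp del: upt_Suc)
    ultimately show ?thesis
      using card_words_gap[of "[1..<Suc k]" "Suc k" "[Suc (Suc k)..<Suc n]" n bs] k bs
      by (simp add: X_def del: upt_Suc)
  qed
  show ?thesis
  proof (cases "n = 2")
    case True
    then have "t 0 = t 1"
      by (simp add: t_def transpose_commute numeral_2_eq_2)
    moreover have "X 0 = {[]}" "X 1 = {[]}"
      using True bs rot_small[of 0] rot_top
      by (simp_all add: X_def words_with_descents_single numeral_2_eq_2 del: upt_Suc)
    ultimately have "(\<Union>k<n. (#) (t k) ` X k) = {[t 0]}"
      using True by (auto simp: numeral_2_eq_2 lessThan_Suc)
    then show ?thesis
      using split True bs by simp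
  next
    case False
    then have n3: "3 \<le> n"
      using n by simp
    have letters_t: "letters (t k) = (if Suc k < n then {Suc k, Suc (Suc k)} else {n, 1})" for k
      using n letters_transpose by (simp add: t_def)
    have t_inj: "k = k'" if "t k = t k'" "k < n" "k' < n" for k k'
    proof -
      have "letters (t k) = letters (t k')"
        using that by simp
      then show ?thesis
        using that(2,3) n3 unfolding letters_t by (auto simp: doubleton_eq_iff split: if_splits)
    qed
    have "card (\<Union>k<n. (#) (t k) ` X k) = (\<Sum>k<n. card ((#) (t k) ` X k))"
      using t_inj by (intro card_UN_disjoint) (auto simp: X_def finite_words_with_descents)
    also have "\<dots> = (\<Sum>k<n. card (X k))"
      by (simp add: card_image)
    also have "\<dots> = (\<Sum>k<n - 1. card (X k)) + card (X (n - 1))"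
      using n by (cases n) auto
    also have "(\<Sum>k<n - 1. card (X k)) = (\<Sum>k\<le>n - 2. gap_count k (n - 2 - k) bs)"
      using n by (intro sum.cong) (auto simp: card_small)
    also have "card (X (n - 1)) = of_bool (\<not> starts_with False bs)"
    proof -
      have "tl (rotate (n - 1) ?v) = [1..<n]" "x (n - 1) = n - 1"
        using rot_top n by (simp_all add: x_def upt_conv_Cons numeral_2_eq_2 del: upt_Suc)
      moreover have "butlast [1..<n] = [1..<n - 1]"
        using n by (cases n) auto
      moreover have "card (words_with_descents n [1..<n] (n - 1) bs) =
          of_bool (\<not> starts_with False bs)"
      proof (rule card_words_increasing(2))
        show "y < n - 1" if "y \<in> set (butlast [1..<n])" for y
          using that unfolding \<open>butlast [1..<n] = [1..<n - 1]\<close> by simp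
      qed (use n bs in auto)
      ultimately show ?thesis
        by (simp only: X_def)
    qed
    also have "\<dots> = of_bool (starts_with True bs)"
      using n3 bs by (cases bs) auto
    finally show ?thesis
      using split sum_gap_count[of bs] bs by simp
  qed
qed

lemma linear_factorizations_eq: "linear_factorizations n = linear_words n [1..<Suc n]"
  by (auto simp: linear_factorizations_def factorizations_def linear_words_def long_cycle_def)

lemma labels_nth:
  assumes "length w = n - 1" "j < n - 1"
  shows "labels n w ! j = edge_labeling n w (Suc j)"
proof -
  have "labels n w ! j =
      the_elem {i \<in> {1..n - 1}. perm_prod (drop j w) i > perm_prod (drop (Suc j) w) i}"
    if "j < length w" for j
    using that
  proof (induction w arbitrary: j)
    case (Cons t w)
    then show ?case by (cases j) auto
  qed simp
  then show ?thesis
    using assms by (simp add: edge_labeling_def drop_set_def partial_prod_def)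
qed

lemma nth_descent_word:
  "Suc i < length xs \<Longrightarrow> descent_word xs ! i \<longleftrightarrow> xs ! i > xs ! Suc i"
proof (induction xs arbitrary: i rule: descent_word.induct)
  case (1 x y xs)
  then show ?case by (cases i) auto
qed auto

lemma fact_Des_eq_iff:
  assumes w: "length w = n - 1" and D: "D \<subseteq> {1..n - 2}"
  shows "fact_Des n w = D \<longleftrightarrow> descent_word (labels n w) = map (\<lambda>i. Suc i \<in> D) [0..<n - 2]"
proof -
  have "descent_word (labels n w) ! i \<longleftrightarrow> Suc i \<in> fact_Des n w" if "i < n - 2" for i
    using that w labels_nth[OF w, of i] labels_nth[OF w, of "Suc i"]
    by (auto simp: nth_descent_word fact_Des_def perm_Des_def)
  then have "descent_word (labels n w) = map (\<lambda>i. Suc i \<in> D) [0..<n - 2] \<longleftrightarrow>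
      (\<forall>i<n - 2. Suc i \<in> fact_Des n w \<longleftrightarrow> Suc i \<in> D)"
    using w by (auto simp: list_eq_iff_nth_eq)
  also have "\<dots> \<longleftrightarrow> (\<forall>i\<in>{1..n - 2}. i \<in> fact_Des n w \<longleftrightarrow> i \<in> D)"
    unfolding image_Suc_lessThan[symmetric] by auto
  also have "\<dots> \<longleftrightarrow> fact_Des n w = D"
    using D by (auto simp: fact_Des_def perm_Des_def)
  finally show ?thesis ..
qed

lemma card_linear_factorizations_with_descents:
  assumes "2 \<le> n" "D \<subseteq> {1..n - 2}"
  shows "card {w \<in> linear_factorizations n. fact_Des n w = D} = Suc (card D)"
proof -
  let ?bs = "map (\<lambda>i. Suc i \<in> D) [0..<n - 2]"
  have len: "length w = n - 1" if "w \<in> linear_factorizations n" for w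
    using that by (simp add: linear_factorizations_def factorizations_def)
  have "{w \<in> linear_factorizations n. fact_Des n w = D} =
      {w \<in> linear_words n [1..<Suc n]. descent_word (labels n w) = ?bs}"
    using fact_Des_eq_iff[OF len assms(2)] linear_factorizations_eq by blast
  moreover have "length (filter id ?bs) = card D"
  proof -
    have "length (filter id ?bs) = card {i. i < n - 2 \<and> Suc i \<in> D}"
      by (simp add: length_filter_conv_card cong: conj_cong)
    also have "\<dots> = card (Suc ` {i. i < n - 2 \<and> Suc i \<in> D})"
      by (simp add: card_image)
    also have "Suc ` {i. i < n - 2 \<and> Suc i \<in> D} = D"
    proof (intro equalityI subsetI)
      fix d assume "d \<in> D"
      moreover from this obtain i where "d = Suc i" "i < n - 2"
        using assms(2) by (cases d) auto
      ultimately show "d \<in> Suc ` {i. i < n - 2 \<and> Suc i \<in> D}"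
        by auto
    qed auto
    finally show ?thesis .
  qed
  ultimately show ?thesis
    using card_linear_words_with_descents[OF assms(1), of ?bs] by simp
qed

section \<open>Coefficients of fundamental quasisymmetric functions\<close>

definition strict_steps :: "nat multiset \<Rightarrow> nat set" where
  "strict_steps M =
     {j \<in> {1..size M - 1}. sorted_list_of_multiset M ! (j - 1) < sorted_list_of_multiset M ! j}"

text \<open>In a sorted list the strict steps are the first positions of all values except the smallest.\<close>

lemma card_strict_steps: "card (strict_steps M) = card (set_mset M) - 1"
proof (cases "M = {#}")
  case True
  then show ?thesis by (simp add: strict_steps_def)
next
  case False
  define s where "s = sorted_list_of_multiset M"
  have s: "sorted s" "mset s = M" "set s = set_mset M" "length s = size M"
    by (simp_all add: s_def) (metis mset_sorted_list_of_multiset size_mset)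
  have ne: "s \<noteq> []"
    using s(2) False by auto
  have mono: "s ! i \<le> s ! j" if "i \<le> j" "j < length s" for i j
    using that s(1) by (simp add: sorted_iff_nth_mono)
  have steps: "strict_steps M = {j. 1 \<le> j \<and> j < length s \<and> s ! (j - 1) < s ! j}" (is "_ = ?S")
    using ne s(4) by (auto simp: strict_steps_def s_def[symmetric])
  have "inj_on ((!) s) ?S"
  proof (rule linorder_inj_onI)
    fix i j assume ij: "i < j" "i \<in> ?S" "j \<in> ?S"
    then have "s ! i \<le> s ! (j - 1)"
      by (intro mono) auto
    with ij show "s ! i \<noteq> s ! j"
      by auto
  qed auto
  moreover have "(!) s ` ?S = set s - {s ! 0}"
  proof (intro equalityI subsetI)
    fix y assume "y \<in> (!) s ` ?S"
    then obtain j where j: "1 \<le> j" "j < length s" "s ! (j - 1) < s ! j" "y = s ! j"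
      by auto
    moreover have "s ! 0 \<le> s ! (j - 1)"
      using j by (intro mono) auto
    ultimately show "y \<in> set s - {s ! 0}"
      by auto
  next
    fix y assume y: "y \<in> set s - {s ! 0}"
    define j where "j = (LEAST j. j < length s \<and> s ! j = y)"
    have "\<exists>j. j < length s \<and> s ! j = y"
      using y by (auto simp: in_set_conv_nth)
    then have j: "j < length s" "s ! j = y"
      unfolding j_def by (metis (mono_tags, lifting) LeastI)+
    then have j0: "1 \<le> j"
      using y by (cases j) auto
    then have "s ! (j - 1) \<noteq> y"
      using not_less_Least[of "j - 1" "\<lambda>j. j < length s \<and> s ! j = y"] j by (auto simp: j_def[symmetric])
    moreover have "s ! (j - 1) \<le> s ! j"
      using j by (intro mono) auto
    ultimately show "y \<in> (!) s ` ?S"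
      using j j0 by (intro image_eqI[of _ _ j]) auto
  qed
  ultimately have "card (strict_steps M) = card (set s - {s ! 0})"
    using steps by (metis card_image)
  also have "\<dots> = card (set_mset M) - 1"
    using ne s(3) nth_mem[of 0 s] by (simp add: card_Diff_singleton)
  finally show ?thesis .
qed

text \<open>The only sequence that can contribute to the coefficient of \<open>M\<close> is the sorted list of \<open>M\<close>.\<close>

lemma fundamental_eq:
  assumes "D \<subseteq> {1..m - 1}"
  shows "fundamental m D M = of_bool (size M = m \<and> D \<subseteq> strict_steps M)"
proof -
  let ?s = "sorted_list_of_multiset M"
  have unique: "s = ?s" if "s \<in> fundamental_seqs m D" "mset s = M" for s
  proof -
    have "s ! i \<le> s ! Suc i" if "Suc i < length s" for i
    proof -
      have "length s = m" "1 \<le> j \<and> j < m \<Longrightarrow> s ! (j - 1) \<le> s ! j" for j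
        using \<open>s \<in> fundamental_seqs m D\<close> unfolding fundamental_seqs_def by blast+
      from this(2)[of "Suc i"] this(1) show ?thesis
        using that by simp
    qed
    then have "sorted s"
      by (simp add: sorted_iff_nth_Suc)
    then show ?thesis
      using \<open>mset s = M\<close> by (metis sorted_list_of_multiset_mset sorted_sort_id)
  qed
  have "{s \<in> fundamental_seqs m D. mset s = M} =
      (if ?s \<in> fundamental_seqs m D then {?s} else {})"
  proof (intro equalityI subsetI)
    fix s assume "s \<in> {s \<in> fundamental_seqs m D. mset s = M}"
    then show "s \<in> (if ?s \<in> fundamental_seqs m D then {?s} else {})"
      using unique[of s] by simp
  next
    fix s assume "s \<in> (if ?s \<in> fundamental_seqs m D then {?s} else {})"
    then show "s \<in> {s \<in> fundamental_seqs m D. mset s = M}"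
      by (simp split: if_splits)
  qed
  moreover have "?s \<in> fundamental_seqs m D \<longleftrightarrow> size M = m \<and> D \<subseteq> strict_steps M"
  proof -
    have len: "length ?s = size M"
      by (metis mset_sorted_list_of_multiset size_mset)
    have mono: "?s ! (j - 1) \<le> ?s ! j" if "j < size M" for j
      using that len sorted_sorted_list_of_multiset[of M] by (simp add: sorted_iff_nth_mono)
    have "?s \<in> fundamental_seqs m D \<longleftrightarrow>
        size M = m \<and> (\<forall>j. 1 \<le> j \<and> j < m \<longrightarrow> j \<in> D \<longrightarrow> ?s ! (j - 1) < ?s ! j)"
      unfolding fundamental_seqs_def mem_Collect_eq len using mono by blast
    also have "\<dots> \<longleftrightarrow> size M = m \<and> (\<forall>j\<in>D. ?s ! (j - 1) < ?s ! j)"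
    proof -
      have "1 \<le> j \<and> j < m" if "j \<in> D" for j
        using that assms by force
      then show ?thesis
        by blast
    qed
    also have "\<dots> \<longleftrightarrow> size M = m \<and> D \<subseteq> strict_steps M"
      unfolding strict_steps_def using assms by blast
    finally show ?thesis .
  qed
  ultimately show ?thesis
    by (simp add: fundamental_def monomial_sum_def)
qed

section \<open>Hook Schur functions\<close>

text \<open>A hook tableau is a sorted first row \<open>r\<close> together with the part \<open>c\<close> of the first column below the
corner \<open>hd r\<close>.\<close>

lemma hook_tableaux:
  assumes "1 \<le> a"
  shows "ssyt (hook a k) = (\<lambda>(r, c). r # map (\<lambda>x. [x]) c) `
    {(r, c). length r = a \<and> length c = k \<and> sorted r \<and> sorted_wrt (<) (hd r # c)}"
    (is "_ = ?f ` ?P")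
proof -
  have cond: "r # map (\<lambda>x. [x]) c \<in> ssyt (hook a k) \<longleftrightarrow> (r, c) \<in> ?P" for r c
  proof -
    let ?T = "r # map (\<lambda>x. [x]) c"
    have shape: "map length ?T = hook a k \<longleftrightarrow> length r = a \<and> length c = k"
    proof -
      have "map length ?T = length r # replicate (length c) 1"
        by (simp add: comp_def map_replicate_const)
      then show ?thesis
        by (metis hook_def length_replicate list.inject)
    qed
    have columns: "(\<forall>i j. i + 1 < length ?T \<and> j < length (?T ! (i + 1)) \<longrightarrow>
        ?T ! i ! j < ?T ! (i + 1) ! j) \<longleftrightarrow> sorted_wrt (<) (hd r # c)" if r: "length r = a"
    proof -
      have first: "?T ! i ! 0 = (hd r # c) ! i" if "i < length c" for i
        using that assms r by (cases r; cases i) auto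
      have "(\<forall>i j. i + 1 < length ?T \<and> j < length (?T ! (i + 1)) \<longrightarrow>
          ?T ! i ! j < ?T ! (i + 1) ! j) \<longleftrightarrow> (\<forall>i<length c. ?T ! i ! 0 < c ! i)"
      proof (intro iffI allI impI)
        fix i assume "\<forall>i j. i + 1 < length ?T \<and> j < length (?T ! (i + 1)) \<longrightarrow>
          ?T ! i ! j < ?T ! (i + 1) ! j" "i < length c"
        then show "?T ! i ! 0 < c ! i"
          by (elim allE[of _ i] allE[of _ 0]) simp
      next
        fix i j assume "\<forall>i<length c. ?T ! i ! 0 < c ! i"
          and ij: "i + 1 < length ?T \<and> j < length (?T ! (i + 1))"
        moreover have "i < length c" "j = 0"
          using ij by auto
        ultimately show "?T ! i ! j < ?T ! (i + 1) ! j"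
          by simp
      qed
      also have "\<dots> \<longleftrightarrow> (\<forall>i<length c. (hd r # c) ! i < c ! i)"
        by (intro all_cong) (simp only: first)
      also have "\<dots> \<longleftrightarrow> sorted_wrt (<) (hd r # c)"
        by (subst sorted_wrt_iff_nth_Suc_transp) (simp_all add: transp_on_less)
      finally show ?thesis .
    qed
    have rows: "(\<forall>x\<in>set ?T. sorted x) \<longleftrightarrow> sorted r"
      by auto
    show ?thesis
      unfolding ssyt_def mem_Collect_eq shape prod.case
      by (cases "length r = a") (simp_all only: rows columns simp_thms)
  qed
  have rows: "\<exists>r c. T = r # map (\<lambda>x. [x]) c" if T: "T \<in> ssyt (hook a k)" for T
  proof -
    obtain r C where rC: "T = r # C" "map length C = replicate k 1"
      using T by (cases T) (auto simp: ssyt_def hook_def)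
    have "length x = 1" if "x \<in> set C" for x
    proof -
      have "length x \<in> set (replicate k 1)"
        using that unfolding rC(2)[symmetric] by simp
      then show ?thesis
        by (simp add: set_replicate_conv_if split: if_splits)
    qed
    note single = this
    have "[hd x] = x" if "x \<in> set C" for x
      using single[OF that] by (cases x) auto
    then have "map (\<lambda>x. [hd x]) C = C"
      by (rule map_idI)
    then have "C = map (\<lambda>x. [x]) (map hd C)"
      by (simp add: comp_def)
    then show ?thesis
      using rC(1) by blast
  qed
  show ?thesis
  proof (intro equalityI subsetI)
    fix T assume T: "T \<in> ssyt (hook a k)"
    then obtain r c where rc: "T = r # map (\<lambda>x. [x]) c"
      using rows by blast
    then have "r # map (\<lambda>x. [x]) c \<in> ssyt (hook a k)"
      using T by simp
    then have "(r, c) \<in> ?P"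
      by (rule iffD1[OF cond])
    then show "T \<in> ?f ` ?P"
      by (rule rev_image_eqI) (simp add: rc)
  next
    fix T assume "T \<in> ?f ` ?P"
    then obtain p where p: "p \<in> ?P" "T = ?f p"
      by (elim imageE)
    then obtain r c where "T = r # map (\<lambda>x. [x]) c" "(r, c) \<in> ?P"
      by (cases p) simp
    then show "T \<in> ssyt (hook a k)"
      using iffD2[OF cond] by simp
  qed
qed

lemma mset_concat_singletons: "mset (concat (map (\<lambda>x. [x]) c)) = mset c"
  by (induction c) auto

text \<open>A hook tableau with content \<open>M\<close> has the minimum of \<open>M\<close> in its corner and is determined by the set of
entries below it: any \<open>k\<close> distinct non-minimal values form the rest of the column, and what
remains of \<open>M\<close>, once sorted, is the first row.\<close>

lemma schur_hook:
  assumes "1 \<le> a"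
  shows "schur (hook a k) M =
    of_bool (size M = a + k) * int ((card (set_mset M) - 1) choose k)"
proof -
  define P where "P = {(r, c). length r = a \<and> length c = k \<and> sorted r \<and>
    sorted_wrt (<) (hd r # c) \<and> mset r + mset c = M}"
  have "{T \<in> ssyt (hook a k). mset (concat T) = M} = (\<lambda>(r, c). r # map (\<lambda>x. [x]) c) ` P"
    unfolding hook_tableaux[OF assms] P_def Compr_image_eq
    by (rule image_cong) (auto simp: mset_concat_singletons)
  moreover have "inj_on (\<lambda>(r, c). r # map (\<lambda>x. [x]) c) P"
    by (auto simp: inj_on_def inj_map_eq_map[OF injI])
  ultimately have schur: "schur (hook a k) M = int (card P)"
    by (simp add: schur_def monomial_sum_def card_image)
  show ?thesis
  proof (cases "size M = a + k")
    case False
    then have "P = {}"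
      by (auto simp: P_def)
    then show ?thesis
      using schur False by simp
  next
    case True
    define m where "m = Min (set_mset M)"
    have "M \<noteq> {#}"
      using True assms by auto
    then have m: "m \<in># M" "\<And>x. x \<in># M \<Longrightarrow> m \<le> x"
      by (simp_all add: m_def)
    define K where "K = {K. K \<subseteq> set_mset M - {m} \<and> card K = k}"
    have "bij_betw (\<lambda>(r, c). set c) P K"
    proof (rule bij_betw_byWitness[where f' =
          "\<lambda>K. (sorted_list_of_multiset (M - mset_set K), sorted_list_of_set K)"])
      show "\<forall>p\<in>P. (\<lambda>K. (sorted_list_of_multiset (M - mset_set K), sorted_list_of_set K))
                    ((\<lambda>(r, c). set c) p) = p"
      proof (clarsimp simp: P_def)
        fix r c :: "nat list"
        assume rc: "sorted r" "sorted_wrt (<) c" "M = mset r + mset c"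
        have c: "sorted c" "distinct c"
          using rc(2) by (auto simp: strict_sorted_iff)
        then have "mset_set (set c) = mset c"
          by (simp add: mset_set_set)
        then show "sorted_list_of_multiset (mset r + mset c - mset_set (set c)) = r \<and>
            sorted_list_of_set (set c) = c"
          using rc c by (simp add: sorted_sort_id sorted_list_of_set.idem_if_sorted_distinct)
      qed
    next
      show "\<forall>X\<in>K. (\<lambda>(r, c). set c)
          (sorted_list_of_multiset (M - mset_set X), sorted_list_of_set X) = X"
        using finite_subset[of _ "set_mset M - {m}"] by (auto simp: K_def)
    next
      show "(\<lambda>(r, c). set c) ` P \<subseteq> K"
      proof (clarsimp simp: P_def K_def)
        fix r c :: "nat list"
        assume rc: "M = mset r + mset c" "a = length r" "k = length c" "sorted r"
          "\<forall>y\<in>set c. hd r < y" "sorted_wrt (<) c"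
        have "hd r \<in># M"
          using rc assms by (cases r) auto
        then have "m \<notin> set c"
          using m(2) rc(5) by (meson not_le)
        moreover have "card (set c) = length c"
          using rc(6) by (simp add: distinct_card strict_sorted_iff)
        ultimately show "set c \<subseteq> set r \<union> set c - {m} \<and> card (set c) = length c"
          by auto
      qed
    next
      show "(\<lambda>X. (sorted_list_of_multiset (M - mset_set X), sorted_list_of_set X)) ` K \<subseteq> P"
      proof (rule image_subsetI)
        fix X assume "X \<in> K"
        then have X: "X \<subseteq> set_mset M - {m}" "card X = k"
          by (auto simp: K_def)
        then have fin: "finite X"
          by (auto intro: finite_subset)
        let ?r = "sorted_list_of_multiset (M - mset_set X)" and ?c = "sorted_list_of_set X"
        have sub: "mset_set X \<subseteq># M"
          using X(1) fin by (auto simp: subseteq_mset_def count_mset_set' Suc_le_eq)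
        have "m \<in> set ?r"
          using X(1) m(1) fin by (auto simp: in_diff_count count_mset_set')
        then obtain x r where r: "?r = x # r"
          by (cases ?r) auto
        then have "x \<le> m"
          using \<open>m \<in> set ?r\<close> sorted_sorted_list_of_multiset[of "M - mset_set X"] by auto
        moreover have "m < y" if "y \<in> X" for y
          using that X(1) m(2)[of y] by (auto simp: order_le_less)
        ultimately have "hd ?r < y" if "y \<in> X" for y
          using that r by fastforce
        moreover have "length ?r = a"
          using True X fin sub size_mset[of ?r] by (simp add: size_Diff_submset)
        moreover have "mset ?r + mset ?c = M"
          using sub by (simp flip: sorted_list_of_mset_set)
        ultimately show "(?r, ?c) \<in> P"
          using X fin by (simp add: P_def)
      qed
    qed
    then have "card P = card K"
      by (rule bij_betw_same_card)
    also have "\<dots> = (card (set_mset M) - 1) choose k"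
      unfolding K_def using m(1) by (simp add: n_subsets card_Diff_singleton)
    finally show ?thesis
      using schur True by simp
  qed
qed

lemma sum_over_subsets:
  assumes "finite S" "card S \<le> N"
  shows "(\<Sum>D\<in>Pow S. g (card D)) = (\<Sum>k = 0..N. int (card S choose k) * g k)"
proof -
  have "(\<Sum>D\<in>Pow S. g (card D)) = (\<Sum>k\<in>{0..N}. \<Sum>D\<in>{D \<in> Pow S. card D = k}. g (card D))"
    using assms by (intro sum.group[symmetric]) (auto intro: order.trans[OF card_mono])
  also have "\<dots> = (\<Sum>k = 0..N. int (card S choose k) * g k)"
    using n_subsets[OF assms(1)] by (intro sum.cong) simp_all
  finally show ?thesis .
qed

section \<open>The Schur expansion\<close>

text \<open>Both sides vanish unless \<open>M\<close> has degree \<open>n - 1\<close>. Otherwise the left side counts the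
factorizations with descent set inside \<open>strict_steps M\<close>, there being \<open>card D + 1\<close> for every
subset \<open>D\<close>, and the right side is the same sum arranged by cardinality.\<close>

lemma quasi_linear_factorizations:
  assumes n: "2 \<le> n"
  shows "quasi (n - 1) (linear_factorizations n) (fact_Des n) M =
    (\<Sum>k = 0..n - 2. (int k + 1) * schur (hook (n - 1 - k) k) M)"
proof -
  let ?L = "linear_factorizations n" and ?S = "strict_steps M"
  have Des: "fact_Des n w \<subseteq> {1..n - 1 - 1}" for w
    by (auto simp: fact_Des_def perm_Des_def)
  have hooks: "schur (hook (n - 1 - k) k) M =
      of_bool (size M = n - 1) * int (card ?S choose k)" if "k \<in> {0..n - 2}" for k
    using that n schur_hook[of "n - 1 - k" k M] by (auto simp: card_strict_steps)
  have "quasi (n - 1) ?L (fact_Des n) M =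
      (\<Sum>w\<in>?L. of_bool (size M = n - 1 \<and> fact_Des n w \<subseteq> ?S))"
    unfolding quasi_def by (intro sum.cong refl fundamental_eq Des)
  also have "\<dots> = (\<Sum>k = 0..n - 2. (int k + 1) * (of_bool (size M = n - 1) * int (card ?S choose k)))"
  proof (cases "size M = n - 1")
    case False
    then show ?thesis by simp
  next
    case True
    then have S: "?S \<subseteq> {1..n - 2}"
      by (auto simp: strict_steps_def)
    then have fin: "finite ?S" and card: "card ?S \<le> n - 2"
      using finite_subset card_mono[OF _ S] by auto
    \<comment> \<open>group the factorizations with descent set inside \<open>?S\<close> by their descent set\<close>
    have "(\<Sum>w\<in>?L. of_bool (size M = n - 1 \<and> fact_Des n w \<subseteq> ?S) :: int) =
        (\<Sum>w\<in>{w \<in> ?L. fact_Des n w \<subseteq> ?S}. 1)"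
      using True finite_linear_factorizations by (simp add: sum.If_cases Int_def flip: of_bool_def)
    also have "\<dots> = (\<Sum>D\<in>Pow ?S. \<Sum>w\<in>{w \<in> {w \<in> ?L. fact_Des n w \<subseteq> ?S}. fact_Des n w = D}. 1)"
      using fin finite_linear_factorizations by (intro sum.group[symmetric]) auto
    also have "\<dots> = (\<Sum>D\<in>Pow ?S. int (card D) + 1)"
    proof (rule sum.cong[OF refl])
      fix D assume D: "D \<in> Pow ?S"
      then have "{w \<in> {w \<in> ?L. fact_Des n w \<subseteq> ?S}. fact_Des n w = D} =
          {w \<in> ?L. fact_Des n w = D}"
        by blast
      then show "(\<Sum>w\<in>{w \<in> {w \<in> ?L. fact_Des n w \<subseteq> ?S}. fact_Des n w = D}. 1) = int (card D) + 1"
        using card_linear_factorizations_with_descents[OF n, of D] D S by force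
    qed
    also have "\<dots> = (\<Sum>k = 0..n - 2. int (card ?S choose k) * (int k + 1))"
      by (rule sum_over_subsets[OF fin card])
    finally show ?thesis
      using True by (simp add: mult.commute)
  qed
  also have "\<dots> = (\<Sum>k = 0..n - 2. (int k + 1) * schur (hook (n - 1 - k) k) M)"
    by (intro sum.cong refl) (simp only: hooks)
  finally show ?thesis .
qed

lemma is_partition_hook:
  assumes "1 \<le> a"
  shows "is_partition (hook a k)"
proof -
  have "sorted_wrt (\<ge>) (replicate k (1::nat))"
    by (induction k) auto
  then show ?thesis
    using assms by (auto simp: is_partition_def hook_def)
qed

theorem theorem3p1p4:
  fixes n :: nat
  assumes "n \<ge> 2"
  shows "quasi (n - 1) (linear_factorizations n) (fact_Des n) =
           (\<lambda>M. \<Sum>k = 0..n - 2. (int k + 1) * schur (hook (n - 1 - k) k) M)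
       \<and> schur_positive (n - 1) (linear_factorizations n) (fact_Des n)"
proof
  let ?Q = "quasi (n - 1) (linear_factorizations n) (fact_Des n)"
  let ?h = "\<lambda>k. hook (n - 1 - k) k"
  show Q: "?Q = (\<lambda>M. \<Sum>k = 0..n - 2. (int k + 1) * schur (?h k) M)"
    by (rule ext) (rule quasi_linear_factorizations[OF assms])
  have "schur (?h k) (image_mset p M) = schur (?h k) M" if "bij p" "k \<in> {0..n - 2}" for p k M
  proof -
    have "card (p ` set_mset M) = card (set_mset M)"
      using that(1) by (intro card_image) (auto simp: bij_def inj_on_def)
    then show ?thesis
      using that(2) assms by (simp add: schur_hook)
  qed
  then have "symmetric ?Q"
    unfolding symmetric_def Q by (auto intro!: sum.cong)
  moreover
  \<comment> \<open>The hook with leg length \<open>k\<close> has \<open>k + 1\<close> parts, so its multiplicity is its number of parts.\<close>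
  define c where "c la = (if la \<in> ?h ` {0..n - 2} then int (length la) else 0)" for la
  have support: "{la. c la \<noteq> 0} = ?h ` {0..n - 2}"
    by (auto simp: c_def hook_def)
  have c_hook: "c (?h k) = int k + 1" if "k \<in> {0..n - 2}" for k
    using that by (auto simp: c_def hook_def)
  have inj: "inj_on ?h {0..n - 2}"
    by (rule inj_onI) (metis hook_def length_Cons length_replicate nat.inject)
  have "schur_expansion ?Q c"
    unfolding schur_expansion_def support
  proof (intro conjI allI impI)
    fix la assume "c la \<noteq> 0"
    then have "la \<in> ?h ` {0..n - 2}"
      using support by blast
    then show "is_partition la"
      using assms by (auto intro!: is_partition_hook)
  next
    show "?Q = (\<lambda>M. \<Sum>la\<in>?h ` {0..n - 2}. c la * schur la M)"
      unfolding Q sum.reindex[OF inj] comp_def by (intro ext sum.cong refl) (simp only: c_hook)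
  qed simp
  moreover have "\<forall>la. 0 \<le> c la"
    by (simp add: c_def)
  ultimately show "schur_positive (n - 1) (linear_factorizations n) (fact_Des n)"
    unfolding schur_positive_def by blast
qed

end
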